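(* The operator $\widetilde{M}:=M_{z_1}+(-z_1^2+z_2)\otimes z_1$ is a $2$-isometry on the Hardy space $(H^2(\mathbb{D}^2),\|\cdot\|_{H^2(\mathbb{D}^2)})$ of the unit bidisc.
   Context: $H^2(\mathbb{D}^2)$ is the Hilbert space of functions $f(z_1,z_2)=\sum_{m,n=0}^\infty a_{m,n}z_1^mz_2^n$ with $\|f\|^2:=\sum_{m,n=0}^\infty|a_{m,n}|^2<\infty$ (so the monomials $z_1^mz_2^n$ form an orthonormal basis). $M_{z_1}$ is the operator $f\mapsto z_1f$. For $u,v\in H^2(\mathbb{D}^2)$, $u\otimes v$ is the operator $(u\otimes v)(f)=\langle f,v\rangle u$, with inner product linear in the first argument. A bounded operator $T$ on a Hilbert space is a $2$-isometry if $I-2T^*T+T^{*2}T^2=0$. *)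

theory Defs
  imports "HOL-Analysis.Analysis"
begin

section \<open>Complex Hilbert spaces and 2-isometries\<close>

text \<open>The real inner product inherited from \<^class>\<open>real_inner\<close> is the real part of the complex
  one; in particular the norm of \<open>x\<close> is \<open>sqrt (Re (cinner x x))\<close>. The complex inner product is
  linear in the first argument.\<close>

class complex_hilbert_space = real_inner + complete_space +
  fixes scaleC :: "complex \<Rightarrow> 'a \<Rightarrow> 'a" (infixr "*\<^sub>C" 75)
    and cinner :: "'a \<Rightarrow> 'a \<Rightarrow> complex"
  assumes scaleC_add_right: "c *\<^sub>C (x + y) = c *\<^sub>C x + c *\<^sub>C y"
    and scaleC_add_left: "(c + d) *\<^sub>C x = c *\<^sub>C x + d *\<^sub>C x"
    and scaleC_scaleC: "c *\<^sub>C d *\<^sub>C x = (c * d) *\<^sub>C x"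
    and scaleR_scaleC: "r *\<^sub>R x = complex_of_real r *\<^sub>C x"
    and cinner_commute: "cinner x y = cnj (cinner y x)"
    and cinner_add_left: "cinner (x + y) z = cinner x z + cinner y z"
    and cinner_scaleC_left: "cinner (c *\<^sub>C x) y = c * cinner x y"
    and inner_eq_Re_cinner: "inner x y = Re (cinner x y)"

definition bounded_operator ::
    "('a::complex_hilbert_space \<Rightarrow> 'b::complex_hilbert_space) \<Rightarrow> bool" where
  "bounded_operator T \<longleftrightarrow> bounded_linear T \<and> (\<forall>c x. T (c *\<^sub>C x) = c *\<^sub>C T x)"

text \<open>For a bounded operator the adjoint exists by the Riesz representation theorem, and it is
  unique because \<^const>\<open>cinner\<close> is nondegenerate.\<close>

definition cadjoint ::
    "('a::complex_hilbert_space \<Rightarrow> 'b::complex_hilbert_space) \<Rightarrow> 'b \<Rightarrow> 'a" where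
  "cadjoint T = (THE S. \<forall>x y. cinner (T x) y = cinner x (S y))"

definition rank_one ::
    "'b::complex_hilbert_space \<Rightarrow> 'a::complex_hilbert_space \<Rightarrow> 'a \<Rightarrow> 'b" where
  "rank_one u v f = cinner f v *\<^sub>C u"

definition two_isometry :: "('a::complex_hilbert_space \<Rightarrow> 'a) \<Rightarrow> bool" where
  "two_isometry T \<longleftrightarrow> bounded_operator T \<and>
     (\<forall>x. x - 2 *\<^sub>R cadjoint T (T x) + (cadjoint T ^^ 2) ((T ^^ 2) x) = 0)"


section \<open>Double power series with square-summable coefficients\<close>

definition bidisc :: "(complex \<times> complex) set" where
  "bidisc = ball 0 1 \<times> ball 0 1"

definition square_summable :: "(nat \<times> nat \<Rightarrow> complex) \<Rightarrow> bool" where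
  "square_summable a \<longleftrightarrow> (\<lambda>p. (cmod (a p))\<^sup>2) summable_on UNIV"

text \<open>Functions on the bidisc are represented as total functions vanishing outside it.\<close>

definition bidisc_series :: "(nat \<times> nat \<Rightarrow> complex) \<Rightarrow> complex \<times> complex \<Rightarrow> complex" where
  "bidisc_series a z =
     (if z \<in> bidisc then \<Sum>\<^sub>\<infinity>(m, n)\<in>UNIV. a (m, n) * fst z ^ m * snd z ^ n else 0)"

lemma square_summable_add:
  assumes "square_summable a" "square_summable b"
  shows "square_summable (\<lambda>p. a p + b p)"
proof -
  have "(\<lambda>p. 2 * (cmod (a p))\<^sup>2 + 2 * (cmod (b p))\<^sup>2) summable_on UNIV"
    using assms unfolding square_summable_def
    by (intro summable_on_add summable_on_cmult_right) auto
  moreover have "(cmod (a p + b p))\<^sup>2 \<le> 2 * (cmod (a p))\<^sup>2 + 2 * (cmod (b p))\<^sup>2" for p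
  proof -
    have "(cmod (a p + b p))\<^sup>2 \<le> (cmod (a p) + cmod (b p))\<^sup>2"
      by (intro power_mono norm_triangle_ineq) auto
    also have "\<dots> \<le> 2 * (cmod (a p))\<^sup>2 + 2 * (cmod (b p))\<^sup>2"
      using zero_le_power2[of "cmod (a p) - cmod (b p)"]
      by (simp add: power2_eq_square algebra_simps)
    finally show ?thesis .
  qed
  ultimately show ?thesis
    unfolding square_summable_def by (rule summable_on_comparison_test) auto
qed

lemma square_summable_cmult:
  assumes "square_summable a"
  shows "square_summable (\<lambda>p. c * a p)"
  using assms unfolding square_summable_def
  by (simp add: norm_mult power_mult_distrib summable_on_cmult_right)

lemma square_summable_diff:
  assumes "square_summable a" "square_summable b"
  shows "square_summable (\<lambda>p. a p - b p)"
  using square_summable_add[OF assms(1) square_summable_cmult[OF assms(2), of "-1"]] by simp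

lemma square_summable_finite_support:
  assumes "finite {p. a p \<noteq> 0}"
  shows "square_summable a"
  unfolding square_summable_def
  by (rule finite_nonzero_values_imp_summable_on) (use assms in simp)

lemma square_summable_mult_summable:
  assumes "square_summable a" "square_summable b"
  shows "(\<lambda>p. a p * b p) summable_on UNIV"
proof -
  have "(\<lambda>p. cmod (a p * b p)) summable_on UNIV"
    using assms unfolding square_summable_def
    by - (rule abs_summable_product; simp add: norm_mult power2_eq_square)
  then show ?thesis
    by (rule abs_summable_summable)
qed

lemma square_summable_cnj: "square_summable a \<Longrightarrow> square_summable (\<lambda>p. cnj (a p))"
  by (simp add: square_summable_def)

lemma square_summable_geometric:
  assumes "z \<in> bidisc"
  shows "square_summable (\<lambda>(m, n). fst z ^ m * snd z ^ n)"
proof -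
  define r s where "r = (cmod (fst z))\<^sup>2" and "s = (cmod (snd z))\<^sup>2"
  have rs: "0 \<le> r" "r < 1" "0 \<le> s" "s < 1"
    using assms by (auto simp: bidisc_def r_def s_def power_less_one_iff abs_square_less_1)
  have r: "(\<lambda>m. r ^ m) summable_on UNIV" and s: "(\<lambda>n. s ^ n) summable_on UNIV"
    using rs by (auto intro!: summable_nonneg_imp_summable_on summable_geometric)
  have "(\<lambda>(m, n). r ^ m * s ^ n) summable_on (UNIV \<times> UNIV)"
  proof (rule summable_on_SigmaI)
    show "((\<lambda>n. case (m, n) of (m, n) \<Rightarrow> r ^ m * s ^ n) has_sum (r ^ m * (\<Sum>\<^sub>\<infinity>n. s ^ n))) UNIV" for m
      using s by (auto intro!: has_sum_cmult_right)
    show "(\<lambda>m. r ^ m * (\<Sum>\<^sub>\<infinity>n. s ^ n)) summable_on UNIV"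
      using r by (intro summable_on_cmult_left) auto
  qed (use rs in auto)
  moreover have "(cmod (case p of (m, n) \<Rightarrow> fst z ^ m * snd z ^ n))\<^sup>2
      = (case p of (m, n) \<Rightarrow> r ^ m * s ^ n)" for p
    by (auto simp: r_def s_def norm_mult norm_power power_mult_distrib split: prod.splits
        simp flip: power_mult) (simp add: mult.commute)
  ultimately show ?thesis
    by (simp add: square_summable_def)
qed

lemma bidisc_series_summable:
  assumes "square_summable a" "z \<in> bidisc"
  shows "(\<lambda>(m, n). a (m, n) * fst z ^ m * snd z ^ n) summable_on UNIV"
  using square_summable_mult_summable[OF assms(1) square_summable_geometric[OF assms(2)]]
  by (simp add: case_prod_unfold mult.assoc)

lemma bidisc_series_add:
  assumes "square_summable a" "square_summable b"
  shows "bidisc_series (\<lambda>p. a p + b p) z = bidisc_series a z + bidisc_series b z"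
proof (cases "z \<in> bidisc")
  case True
  show ?thesis
    using infsum_add[OF bidisc_series_summable[OF assms(1) True]
        bidisc_series_summable[OF assms(2) True]] True
    by (simp add: bidisc_series_def case_prod_unfold distrib_right)
qed (simp add: bidisc_series_def)

lemma bidisc_series_cmult: "bidisc_series (\<lambda>p. c * a p) z = c * bidisc_series a z"
  by (simp add: bidisc_series_def case_prod_unfold mult.assoc flip: infsum_cmult_right')

lemma power_series_coeff_0:
  fixes c :: "nat \<Rightarrow> complex"
  assumes "\<And>z. cmod z < 1 \<Longrightarrow> (\<lambda>n. c n * z ^ n) sums 0"
  shows "c n = 0"
proof -
  have "ereal (cmod (1 / 2)) \<le> conv_radius c"
    by (rule conv_radius_geI) (use assms[of "1 / 2"] in \<open>auto simp: sums_iff\<close>)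
  then have pos: "0 < fps_conv_radius (Abs_fps c)"
    unfolding fps_conv_radius_def by (auto intro: less_le_trans[of _ "ereal (1 / 2)"])
  have "eventually (\<lambda>z. z \<in> ball 0 1) (nhds (0 :: complex))"
    by (intro eventually_nhds_in_open) auto
  then have "eventually (\<lambda>z. eval_fps (Abs_fps c) z = eval_fps 0 z) (nhds 0)"
  proof (rule eventually_mono)
    fix z :: complex
    assume "z \<in> ball 0 1"
    then show "eval_fps (Abs_fps c) z = eval_fps 0 z"
      using assms[of z] by (simp add: eval_fps_def sums_iff)
  qed
  then have "Abs_fps c = 0"
    using pos by (intro eval_fps_eqD) auto
  then show ?thesis
    by (metis fps_nth_Abs_fps fps_zero_nth)
qed

lemma bidisc_series_eq_0:
  assumes "square_summable a" "\<And>z. bidisc_series a z = 0"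
  shows "a p = 0"
proof -
  have sums: "(\<lambda>m. (\<Sum>\<^sub>\<infinity>n. a (m, n) * w ^ n) * z ^ m) sums 0"
      and sum_on: "(\<lambda>n. a (m, n) * w ^ n) summable_on UNIV"
    if z: "cmod z < 1" and w: "cmod w < 1" for z w m
  proof -
    have row: "(\<lambda>n. a (m, n) * w ^ n) summable_on UNIV" for m
    proof -
      have "(1 / 2, w) \<in> bidisc"
        using w by (auto simp: bidisc_def)
      then have "(\<lambda>(m, n). a (m, n) * (1 / 2) ^ m * w ^ n) summable_on (UNIV \<times> UNIV)"
        using bidisc_series_summable[OF assms(1)] by fastforce
      then have "(\<lambda>n. a (m, n) * (1 / 2) ^ m * w ^ n) summable_on UNIV"
        using summable_on_SigmaD1[of "\<lambda>m n. a (m, n) * (1 / 2) ^ m * w ^ n" UNIV "\<lambda>_. UNIV" m]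
        by auto
      then have "(\<lambda>n. 2 ^ m * (a (m, n) * (1 / 2) ^ m * w ^ n)) summable_on UNIV"
        by (rule summable_on_cmult_right)
      then show ?thesis
        by (simp add: power_one_over field_simps)
    qed
    then show "(\<lambda>n. a (m, n) * w ^ n) summable_on UNIV" .
    have zw: "(z, w) \<in> bidisc"
      using z w by (auto simp: bidisc_def)
    have "((\<lambda>(m, n). a (m, n) * z ^ m * w ^ n) has_sum 0) (UNIV \<times> UNIV)"
      using bidisc_series_summable[OF assms(1) zw] assms(2)[of "(z, w)"] zw
      by (auto simp: bidisc_series_def has_sum_iff)
    moreover have "((\<lambda>n. case (m, n) of (m, n) \<Rightarrow> a (m, n) * z ^ m * w ^ n)
        has_sum (\<Sum>\<^sub>\<infinity>n. a (m, n) * w ^ n) * z ^ m) UNIV" for m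
      using has_sum_cmult_left[OF has_sum_infsum[OF row[of m]], of "z ^ m"]
      by (simp add: mult_ac)
    ultimately have "((\<lambda>m. (\<Sum>\<^sub>\<infinity>n. a (m, n) * w ^ n) * z ^ m) has_sum 0) UNIV"
      by (rule has_sum_SigmaD)
    then show "(\<lambda>m. (\<Sum>\<^sub>\<infinity>n. a (m, n) * w ^ n) * z ^ m) sums 0"
      by (rule has_sum_imp_sums)
  qed
  obtain m n where p: "p = (m, n)"
    by fastforce
  have "(\<lambda>n. a (m, n) * w ^ n) sums 0" if w: "cmod w < 1" for w
  proof -
    have "(\<Sum>\<^sub>\<infinity>n. a (m, n) * w ^ n) = 0"
      using power_series_coeff_0[of "\<lambda>m. \<Sum>\<^sub>\<infinity>n. a (m, n) * w ^ n" m] sums w by blast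
    then show ?thesis
      using has_sum_imp_sums[OF has_sum_infsum[OF sum_on[of 0 w m]]] w by simp
  qed
  then show ?thesis
    using power_series_coeff_0[of "\<lambda>n. a (m, n)" n] p by blast
qed

lemma bidisc_series_inject:
  assumes "square_summable a" "square_summable b" "bidisc_series a = bidisc_series b"
  shows "a = b"
proof
  fix p
  have "bidisc_series (\<lambda>p. a p + (-1) * b p) z = 0" for z
    using bidisc_series_add[OF assms(1) square_summable_cmult[OF assms(2), of "-1"]]
      bidisc_series_cmult[of "-1" b] assms(3) by simp
  then show "a p = b p"
    using bidisc_series_eq_0[of "\<lambda>p. a p + (-1) * b p" p]
      square_summable_add[OF assms(1) square_summable_cmult[OF assms(2), of "-1"]] by simp
qed


section \<open>The Hardy space of the bidisc\<close>

typedef hardy_bidisc = "{f. \<exists>a. square_summable a \<and> f = bidisc_series a}"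
  morphisms hardy_fun Abs_hardy_bidisc
  using square_summable_finite_support[of "\<lambda>_. 0"] by auto

setup_lifting type_definition_hardy_bidisc

definition hardy_coeff :: "hardy_bidisc \<Rightarrow> nat \<times> nat \<Rightarrow> complex" where
  "hardy_coeff f = (THE a. square_summable a \<and> hardy_fun f = bidisc_series a)"

lemma hardy_coeff_eqI:
  assumes "square_summable a" "hardy_fun f = bidisc_series a"
  shows "hardy_coeff f = a"
  unfolding hardy_coeff_def
  by (rule the_equality) (use assms bidisc_series_inject in auto)

lemma hardy_coeff: "square_summable (hardy_coeff f)" "hardy_fun f = bidisc_series (hardy_coeff f)"
proof -
  obtain a where a: "square_summable a" "hardy_fun f = bidisc_series a"
    using hardy_fun[of f] by auto
  then show "square_summable (hardy_coeff f)" "hardy_fun f = bidisc_series (hardy_coeff f)"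
    by (simp_all add: hardy_coeff_eqI)
qed

lemma hardy_coeff_inject: "hardy_coeff f = hardy_coeff g \<longleftrightarrow> f = g"
  by (metis hardy_coeff(2) hardy_fun_inject)

lemma hardy_coeff_surj:
  assumes "square_summable a"
  obtains f where "hardy_coeff f = a"
proof
  show "hardy_coeff (Abs_hardy_bidisc (bidisc_series a)) = a"
    by (rule hardy_coeff_eqI) (use assms in \<open>auto intro!: Abs_hardy_bidisc_inverse\<close>)
qed

instantiation hardy_bidisc :: real_vector
begin

lift_definition zero_hardy_bidisc :: hardy_bidisc is "\<lambda>_. 0"
proof -
  show "\<exists>a. square_summable a \<and> (\<lambda>_. 0) = bidisc_series a"
    by (rule exI[of _ "\<lambda>_. 0"])
      (auto simp: bidisc_series_def case_prod_unfold intro: square_summable_finite_support)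
qed

lift_definition plus_hardy_bidisc :: "hardy_bidisc \<Rightarrow> hardy_bidisc \<Rightarrow> hardy_bidisc"
  is "\<lambda>f g z. f z + g z"
proof -
  fix f g assume "\<exists>a. square_summable a \<and> f = bidisc_series a"
    and "\<exists>a. square_summable a \<and> g = bidisc_series a"
  then obtain a b where "square_summable a" "f = bidisc_series a"
    and "square_summable b" "g = bidisc_series b" by blast
  then show "\<exists>a. square_summable a \<and> (\<lambda>z. f z + g z) = bidisc_series a"
    by (intro exI[of _ "\<lambda>p. a p + b p"]) (auto simp: square_summable_add bidisc_series_add)
qed

lift_definition uminus_hardy_bidisc :: "hardy_bidisc \<Rightarrow> hardy_bidisc" is "\<lambda>f z. - f z"
proof -
  fix f assume "\<exists>a. square_summable a \<and> f = bidisc_series a"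
  then obtain a where "square_summable a" "f = bidisc_series a" by blast
  then show "\<exists>a. square_summable a \<and> (\<lambda>z. - f z) = bidisc_series a"
    using square_summable_cmult[of a "-1"] bidisc_series_cmult[of "-1" a]
    by (intro exI[of _ "\<lambda>p. -1 * a p"]) auto
qed

definition minus_hardy_bidisc :: "hardy_bidisc \<Rightarrow> hardy_bidisc \<Rightarrow> hardy_bidisc" where
  "minus_hardy_bidisc f g = f + - g"

lift_definition scaleR_hardy_bidisc :: "real \<Rightarrow> hardy_bidisc \<Rightarrow> hardy_bidisc"
  is "\<lambda>r f z. complex_of_real r * f z"
proof -
  fix r :: real and f assume "\<exists>a. square_summable a \<and> f = bidisc_series a"
  then obtain a where "square_summable a" "f = bidisc_series a" by blast
  then show "\<exists>a. square_summable a \<and> (\<lambda>z. complex_of_real r * f z) = bidisc_series a"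
    using square_summable_cmult[of a r] bidisc_series_cmult[of r a]
    by (intro exI[of _ "\<lambda>p. r * a p"]) auto
qed

instance
  by (standard; (simp only: minus_hardy_bidisc_def)?; (transfer, simp add: algebra_simps)?)

end

lift_definition scaleC_hardy :: "complex \<Rightarrow> hardy_bidisc \<Rightarrow> hardy_bidisc" is "\<lambda>c f z. c * f z"
proof -
  fix c and f assume "\<exists>a. square_summable a \<and> f = bidisc_series a"
  then obtain a where "square_summable a" "f = bidisc_series a" by blast
  then show "\<exists>a. square_summable a \<and> (\<lambda>z. c * f z) = bidisc_series a"
    using square_summable_cmult[of a c] bidisc_series_cmult[of c a]
    by (intro exI[of _ "\<lambda>p. c * a p"]) auto
qed

lemma hardy_coeff_zero: "hardy_coeff 0 = (\<lambda>_. 0)"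
  by (rule hardy_coeff_eqI)
    (auto simp: zero_hardy_bidisc.rep_eq bidisc_series_def case_prod_unfold
      intro: square_summable_finite_support)

lemma hardy_coeff_add: "hardy_coeff (f + g) = (\<lambda>p. hardy_coeff f p + hardy_coeff g p)"
  by (rule hardy_coeff_eqI)
    (auto simp: plus_hardy_bidisc.rep_eq square_summable_add bidisc_series_add hardy_coeff(1)
      simp flip: hardy_coeff(2))

lemma hardy_coeff_scaleC: "hardy_coeff (scaleC_hardy c f) = (\<lambda>p. c * hardy_coeff f p)"
  by (rule hardy_coeff_eqI)
    (auto simp: scaleC_hardy.rep_eq square_summable_cmult bidisc_series_cmult hardy_coeff(1)
      simp flip: hardy_coeff(2))

lemma scaleR_hardy_eq: "r *\<^sub>R f = scaleC_hardy (complex_of_real r) f" for f :: hardy_bidisc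
  by transfer simp

lemma hardy_coeff_diff: "hardy_coeff (f - g) = (\<lambda>p. hardy_coeff f p - hardy_coeff g p)"
proof -
  have "- g = scaleC_hardy (-1) g"
    by transfer simp
  then have "f - g = f + scaleC_hardy (-1) g"
    by (simp only: minus_hardy_bidisc_def)
  then show ?thesis
    by (simp only: hardy_coeff_add hardy_coeff_scaleC) simp
qed

definition cinner_hardy :: "hardy_bidisc \<Rightarrow> hardy_bidisc \<Rightarrow> complex" where
  "cinner_hardy f g = (\<Sum>\<^sub>\<infinity>p. hardy_coeff f p * cnj (hardy_coeff g p))"

lemma cinner_hardy_summable: "(\<lambda>p. hardy_coeff f p * cnj (hardy_coeff g p)) summable_on UNIV"
  by (intro square_summable_mult_summable square_summable_cnj hardy_coeff)

lemma cinner_hardy_commute: "cinner_hardy f g = cnj (cinner_hardy g f)"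
  by (simp add: cinner_hardy_def mult.commute flip: infsum_cnj)

lemma cinner_hardy_add_left: "cinner_hardy (f + g) h = cinner_hardy f h + cinner_hardy g h"
  by (simp add: cinner_hardy_def hardy_coeff_add distrib_right cinner_hardy_summable
      flip: infsum_add)

lemma cinner_hardy_scaleC_left: "cinner_hardy (scaleC_hardy c f) g = c * cinner_hardy f g"
  by (simp add: cinner_hardy_def hardy_coeff_scaleC mult.assoc infsum_cmult_right')

lemma cinner_hardy_self:
  "cinner_hardy f f = complex_of_real (\<Sum>\<^sub>\<infinity>p. (cmod (hardy_coeff f p))\<^sup>2)"
proof -
  have "((\<lambda>p. complex_of_real ((cmod (hardy_coeff f p))\<^sup>2))
      has_sum complex_of_real (\<Sum>\<^sub>\<infinity>p. (cmod (hardy_coeff f p))\<^sup>2)) UNIV"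
    using hardy_coeff(1)[of f] unfolding square_summable_def
    by (intro has_sum_of_real has_sum_infsum)
  then show ?thesis
    unfolding cinner_hardy_def by (intro infsumI) (simp only: complex_norm_square)
qed

instantiation hardy_bidisc :: real_inner
begin

definition inner_hardy_bidisc :: "hardy_bidisc \<Rightarrow> hardy_bidisc \<Rightarrow> real" where
  "inner_hardy_bidisc f g = Re (cinner_hardy f g)"

definition norm_hardy_bidisc :: "hardy_bidisc \<Rightarrow> real" where
  "norm_hardy_bidisc f = sqrt (\<Sum>\<^sub>\<infinity>p. (cmod (hardy_coeff f p))\<^sup>2)"

definition sgn_hardy_bidisc :: "hardy_bidisc \<Rightarrow> hardy_bidisc" where
  "sgn_hardy_bidisc f = f /\<^sub>R norm f"

definition dist_hardy_bidisc :: "hardy_bidisc \<Rightarrow> hardy_bidisc \<Rightarrow> real" where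
  "dist_hardy_bidisc f g = norm (f - g)"

definition uniformity_hardy_bidisc :: "(hardy_bidisc \<times> hardy_bidisc) filter" where
  "uniformity_hardy_bidisc = (INF e\<in>{0 <..}. principal {(x, y). dist x y < e})"

definition open_hardy_bidisc :: "hardy_bidisc set \<Rightarrow> bool" where
  "open_hardy_bidisc U \<longleftrightarrow> (\<forall>x\<in>U. eventually (\<lambda>(x', y). x' = x \<longrightarrow> y \<in> U) uniformity)"

instance
proof
  fix f g h :: hardy_bidisc and r :: real and U :: "hardy_bidisc set"
  show "inner f g = inner g f"
    unfolding inner_hardy_bidisc_def by (subst cinner_hardy_commute) simp
  show "inner (f + g) h = inner f h + inner g h"
    by (simp add: inner_hardy_bidisc_def cinner_hardy_add_left)
  show "inner (r *\<^sub>R f) g = r * inner f g"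
    by (simp add: inner_hardy_bidisc_def scaleR_hardy_eq cinner_hardy_scaleC_left)
  show "0 \<le> inner f f"
    by (simp add: inner_hardy_bidisc_def cinner_hardy_self infsum_nonneg)
  show "norm f = sqrt (inner f f)"
    by (simp add: inner_hardy_bidisc_def cinner_hardy_self norm_hardy_bidisc_def)
  show "inner f f = 0 \<longleftrightarrow> f = 0"
  proof
    assume "inner f f = 0"
    then have "(\<Sum>\<^sub>\<infinity>p. (cmod (hardy_coeff f p))\<^sup>2) \<le> 0"
      by (simp add: inner_hardy_bidisc_def cinner_hardy_self)
    then have "(cmod (hardy_coeff f p))\<^sup>2 = 0" for p
      using hardy_coeff(1)[of f] unfolding square_summable_def
      by (rule nonneg_infsum_le_0D) auto
    then have "hardy_coeff f = hardy_coeff 0"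
      by (auto simp: hardy_coeff_zero)
    then show "f = 0"
      by (simp add: hardy_coeff_inject)
  qed (simp add: inner_hardy_bidisc_def cinner_hardy_self hardy_coeff_zero)
qed (rule sgn_hardy_bidisc_def dist_hardy_bidisc_def uniformity_hardy_bidisc_def
    open_hardy_bidisc_def)+

end

lemma sum_coeff_le_norm:
  assumes "finite F"
  shows "(\<Sum>p\<in>F. (cmod (hardy_coeff f p))\<^sup>2) \<le> (norm f)\<^sup>2"
proof -
  have "(\<Sum>p\<in>F. (cmod (hardy_coeff f p))\<^sup>2) \<le> (\<Sum>\<^sub>\<infinity>p. (cmod (hardy_coeff f p))\<^sup>2)"
    using hardy_coeff(1)[of f] assms unfolding square_summable_def
    by (intro finite_sum_le_infsum) auto
  then show ?thesis
    by (simp add: norm_hardy_bidisc_def infsum_nonneg)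
qed

instantiation hardy_bidisc :: complex_hilbert_space
begin

definition scaleC_hardy_bidisc :: "complex \<Rightarrow> hardy_bidisc \<Rightarrow> hardy_bidisc" where
  "scaleC_hardy_bidisc = scaleC_hardy"

definition cinner_hardy_bidisc :: "hardy_bidisc \<Rightarrow> hardy_bidisc \<Rightarrow> complex" where
  "cinner_hardy_bidisc = cinner_hardy"

instance
proof
  fix X :: "nat \<Rightarrow> hardy_bidisc"
  assume X: "Cauchy X"
  define b where "b p = lim (\<lambda>n. hardy_coeff (X n) p)" for p
  have lim: "(\<lambda>n. hardy_coeff (X n) p) \<longlonglongrightarrow> b p" for p
  proof -
    have "cmod (hardy_coeff (X m) p - hardy_coeff (X n) p) \<le> norm (X m - X n)" for m n
      using sum_coeff_le_norm[of "{p}" "X m - X n"]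
      by (auto simp: hardy_coeff_diff intro: power2_le_imp_le)
    then have "Cauchy (\<lambda>n. hardy_coeff (X n) p)"
      using X unfolding Cauchy_iff by (meson le_less_trans)
    then show ?thesis
      unfolding b_def by (simp add: Cauchy_convergent_iff convergent_LIMSEQ_iff)
  qed
  have bound: "\<exists>N. \<forall>m\<ge>N. \<forall>F. finite F \<longrightarrow> (\<Sum>p\<in>F. (cmod (hardy_coeff (X m) p - b p))\<^sup>2) \<le> e\<^sup>2"
    if "e > 0" for e
  proof -
    obtain N where N: "\<And>m n. m \<ge> N \<Longrightarrow> n \<ge> N \<Longrightarrow> norm (X m - X n) < e"
      using X \<open>e > 0\<close> unfolding Cauchy_iff by meson
    have "(\<Sum>p\<in>F. (cmod (hardy_coeff (X m) p - b p))\<^sup>2) \<le> e\<^sup>2" if "m \<ge> N" "finite F" for m F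
    proof (rule tendsto_upperbound)
      show "(\<lambda>n. \<Sum>p\<in>F. (cmod (hardy_coeff (X m) p - hardy_coeff (X n) p))\<^sup>2)
          \<longlonglongrightarrow> (\<Sum>p\<in>F. (cmod (hardy_coeff (X m) p - b p))\<^sup>2)"
        by (intro tendsto_intros lim)
      have "(\<Sum>p\<in>F. (cmod (hardy_coeff (X m) p - hardy_coeff (X n) p))\<^sup>2) \<le> e\<^sup>2"
        if "n \<ge> N" for n
      proof -
        have "(\<Sum>p\<in>F. (cmod (hardy_coeff (X m) p - hardy_coeff (X n) p))\<^sup>2)
            \<le> (norm (X m - X n))\<^sup>2"
          using sum_coeff_le_norm[OF \<open>finite F\<close>, of "X m - X n"] by (simp add: hardy_coeff_diff)
        also have "\<dots> \<le> e\<^sup>2"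
          using N[OF \<open>m \<ge> N\<close> that] by (intro power_mono) auto
        finally show ?thesis .
      qed
      then show "\<forall>\<^sub>F n in sequentially.
          (\<Sum>p\<in>F. (cmod (hardy_coeff (X m) p - hardy_coeff (X n) p))\<^sup>2) \<le> e\<^sup>2"
        by (auto simp: eventually_sequentially)
    qed simp
    then show ?thesis
      by blast
  qed
  have sq: "square_summable (\<lambda>p. hardy_coeff (X m) p - b p)"
    if "\<forall>F. finite F \<longrightarrow> (\<Sum>p\<in>F. (cmod (hardy_coeff (X m) p - b p))\<^sup>2) \<le> e\<^sup>2" for m e
    unfolding square_summable_def
    by (rule nonneg_bdd_above_summable_on) (use that in \<open>auto intro!: bdd_aboveI2\<close>)
  obtain N where "\<forall>F. finite F \<longrightarrow> (\<Sum>p\<in>F. (cmod (hardy_coeff (X N) p - b p))\<^sup>2) \<le> 1\<^sup>2"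
    using bound[of 1] by auto
  from square_summable_diff[OF hardy_coeff(1) sq[OF this], of "X N"]
  have "square_summable b"
    by simp
  then obtain f where f: "hardy_coeff f = b"
    by (rule hardy_coeff_surj)
  have "X \<longlonglongrightarrow> f"
  proof (rule LIMSEQ_I)
    fix r :: real
    assume "0 < r"
    then obtain N where
      N: "\<And>m. m \<ge> N \<Longrightarrow> \<forall>F. finite F \<longrightarrow> (\<Sum>p\<in>F. (cmod (hardy_coeff (X m) p - b p))\<^sup>2) \<le> (r / 2)\<^sup>2"
      using bound[of "r / 2"] by (metis half_gt_zero)
    have "norm (X m - f) < r" if "m \<ge> N" for m
    proof -
      have "(\<Sum>\<^sub>\<infinity>p. (cmod (hardy_coeff (X m) p - b p))\<^sup>2) \<le> (r / 2)\<^sup>2"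
        using sq[OF N[OF that]] N[OF that] unfolding square_summable_def
        by (intro infsum_le_finite_sums) auto
      then have "norm (X m - f) \<le> r / 2"
        unfolding norm_hardy_bidisc_def hardy_coeff_diff f
        using \<open>0 < r\<close> by (intro real_le_lsqrt infsum_nonneg) auto
      then show ?thesis
        using \<open>0 < r\<close> by simp
    qed
    then show "\<exists>N. \<forall>m\<ge>N. norm (X m - f) < r"
      by blast
  qed
  then show "convergent X"
    by (rule convergentI)
next
  fix c d :: complex and r :: real and f g h :: hardy_bidisc
  show "scaleC c (f + g) = scaleC c f + scaleC c g"
    unfolding scaleC_hardy_bidisc_def by transfer (auto simp: distrib_left)
  show "scaleC (c + d) f = scaleC c f + scaleC d f"
    unfolding scaleC_hardy_bidisc_def by transfer (auto simp: distrib_right)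
  show "scaleC c (scaleC d f) = scaleC (c * d) f"
    unfolding scaleC_hardy_bidisc_def by transfer (auto simp: mult.assoc)
  show "r *\<^sub>R f = scaleC (complex_of_real r) f"
    by (simp add: scaleC_hardy_bidisc_def scaleR_hardy_eq)
  show "cinner f g = cnj (cinner g f)"
    by (simp add: cinner_hardy_bidisc_def flip: cinner_hardy_commute)
  show "cinner (f + g) h = cinner f h + cinner g h"
    by (simp add: cinner_hardy_bidisc_def cinner_hardy_add_left)
  show "cinner (scaleC c f) g = c * cinner f g"
    by (simp add: cinner_hardy_bidisc_def scaleC_hardy_bidisc_def cinner_hardy_scaleC_left)
  show "inner f g = Re (cinner f g)"
    by (simp add: cinner_hardy_bidisc_def inner_hardy_bidisc_def)
qed

end

lift_definition hardy_monom :: "nat \<Rightarrow> nat \<Rightarrow> hardy_bidisc"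
  is "\<lambda>m n z. if z \<in> bidisc then fst z ^ m * snd z ^ n else 0"
proof -
  fix m n :: nat
  define a :: "nat \<times> nat \<Rightarrow> complex" where "a p = (if p = (m, n) then 1 else 0)" for p
  have "square_summable a"
    by (rule square_summable_finite_support) (simp add: a_def)
  moreover have "(\<Sum>\<^sub>\<infinity>(i, j). a (i, j) * fst z ^ i * snd z ^ j) = fst z ^ m * snd z ^ n" for z
  proof -
    have "(\<Sum>\<^sub>\<infinity>(i, j). a (i, j) * fst z ^ i * snd z ^ j)
        = (\<Sum>\<^sub>\<infinity>(i, j)\<in>{(m, n)}. a (i, j) * fst z ^ i * snd z ^ j)"
      by (rule infsum_cong_neutral) (auto simp: a_def split: if_splits)
    then show ?thesis
      by (simp add: a_def)
  qed
  ultimately show "\<exists>a. square_summable a \<and>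
      (\<lambda>z. if z \<in> bidisc then fst z ^ m * snd z ^ n else 0) = bidisc_series a"
    by (intro exI[of _ a]) (auto simp: bidisc_series_def)
qed

lift_definition mult_z1 :: "hardy_bidisc \<Rightarrow> hardy_bidisc" is "\<lambda>f z. fst z * f z"
proof -
  fix f assume "\<exists>a. square_summable a \<and> f = bidisc_series a"
  then obtain a where a: "square_summable a" and f: "f = bidisc_series a"
    by blast
  define h :: "nat \<times> nat \<Rightarrow> nat \<times> nat" where "h = (\<lambda>(m, n). (Suc m, n))"
  define b where "b = (\<lambda>(m, n). if m = 0 then 0 else a (m - 1, n))"
  have inj: "inj h"
    by (auto simp: h_def inj_on_def)
  have range: "p \<in> range h" if "fst p \<noteq> 0" for p
    using that by (cases p; cases "fst p") (auto simp: h_def image_iff)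
  have bh: "b (h p) = a p" for p
    by (auto simp: b_def h_def split: prod.splits)
  have b0: "b p = 0" if "p \<notin> range h" for p
    using range[of p] that by (auto simp: b_def split: prod.splits)
  have "square_summable b"
  proof -
    have "(\<lambda>p. (cmod (b p))\<^sup>2) summable_on range h"
      using a inj by (simp add: summable_on_reindex comp_def bh square_summable_def)
    then show ?thesis
      unfolding square_summable_def
      by (rule summable_on_cong_neutral[THEN iffD1, rotated -1]) (auto simp: b0)
  qed
  moreover have "fst z * f z = bidisc_series b z" for z
  proof (cases "z \<in> bidisc")
    case True
    have "(\<Sum>\<^sub>\<infinity>(m, n). b (m, n) * fst z ^ m * snd z ^ n)
        = (\<Sum>\<^sub>\<infinity>p\<in>range h. b p * fst z ^ fst p * snd z ^ snd p)"
      by (rule infsum_cong_neutral) (simp_all add: case_prod_unfold b0)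
    also have "\<dots> = (\<Sum>\<^sub>\<infinity>p. b (h p) * fst z ^ fst (h p) * snd z ^ snd (h p))"
      using inj by (simp add: infsum_reindex comp_def)
    also have "\<dots> = (\<Sum>\<^sub>\<infinity>(m, n). fst z * (a (m, n) * fst z ^ m * snd z ^ n))"
      by (rule infsum_cong) (auto simp: bh, auto simp: h_def)
    also have "\<dots> = fst z * (\<Sum>\<^sub>\<infinity>(m, n). a (m, n) * fst z ^ m * snd z ^ n)"
      by (simp add: case_prod_unfold infsum_cmult_right')
    finally show ?thesis
      using True by (simp add: f bidisc_series_def)
  qed (simp add: f bidisc_series_def)
  ultimately show "\<exists>a. square_summable a \<and> (\<lambda>z. fst z * f z) = bidisc_series a"
    by blast
qed

end

theory Submission
  imports Defs
begin

text \<open>The operator maps \<open>z\<^sub>1\<close> to \<open>z\<^sub>2\<close> and every other monomial \<open>z\<^sub>1\<^sup>m z\<^sub>2\<^sup>n\<close> to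
  \<open>z\<^sub>1\<^bsup>m+1\<^esup> z\<^sub>2\<^sup>n\<close>. It thus maps the orthonormal basis of monomials injectively into
  itself, so it is an isometry, \<open>T\<^sup>*T = I\<close>, and in particular a 2-isometry.\<close>

lemma cinner_extensionality:
  fixes u v :: "'a::complex_hilbert_space"
  assumes "\<And>z. cinner z u = cinner z v"
  shows "u = v"
proof -
  have "inner z u = inner z v" for z
    by (simp add: inner_eq_Re_cinner assms)
  then show ?thesis
    by (rule vector_eq_ldot[THEN iffD1, rule_format])
qed

text \<open>Nondegeneracy of \<open>cinner\<close> gives the uniqueness that the definite
  description demands, so exhibiting one \<open>S\<close> identifies the adjoint.\<close>

lemma cadjoint_eqI:
  assumes "\<And>x y. cinner (T x) y = cinner x (S y)"
  shows "cadjoint T = S"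
  unfolding cadjoint_def
proof (rule the_equality)
  fix S' assume "\<forall>x y. cinner (T x) y = cinner x (S' y)"
  then have "cinner x (S' y) = cinner x (S y)" for x y
    by (metis assms)
  then show "S' = S"
    by (blast intro: cinner_extensionality)
qed (simp add: assms)

text \<open>Pairing with an arbitrary vector and moving \<open>T\<close> across as \<open>S\<close>
  yields linearity. The norm is preserved because
  \<open>cinner (T x) (T x) = cinner x (S (T x))\<close>.\<close>

lemma bounded_operator_isometry:
  fixes T :: "'a::complex_hilbert_space \<Rightarrow> 'b::complex_hilbert_space"
  assumes adj: "\<And>x y. cinner (T x) y = cinner x (S y)" and inverse: "\<And>x. S (T x) = x"
  shows "bounded_operator T"
  unfolding bounded_operator_def
proof (intro conjI allI)
  have ext: "u = v" if "\<And>z. cinner u z = cinner v z" for u v :: 'b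
    by (rule cinner_extensionality) (metis cinner_commute that)
  show scaleC: "T (c *\<^sub>C x) = c *\<^sub>C T x" for c x
    by (rule ext) (simp add: adj cinner_scaleC_left)
  have "norm (T x) = norm x" for x
    by (simp add: norm_eq_sqrt_inner inner_eq_Re_cinner adj inverse)
  moreover have "T (x + y) = T x + T y" for x y
    by (rule ext) (simp add: adj cinner_add_left)
  ultimately show "bounded_linear T"
    by (intro bounded_linear_intro[of _ 1]) (simp_all add: scaleR_scaleC scaleC)
qed

text \<open>Once \<open>S\<close> is the adjoint and \<open>S (T x) = x\<close>, the defining
  expression collapses to \<open>x - 2x + x\<close>.\<close>

lemma two_isometry_isometry:
  assumes adj: "\<And>x y. cinner (T x) y = cinner x (S y)" and inverse: "\<And>x. S (T x) = x"
  shows "two_isometry T"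
proof -
  have "bounded_operator T"
    by (rule bounded_operator_isometry) (rule adj, rule inverse)
  moreover have "cadjoint T = S"
    by (rule cadjoint_eqI) (rule adj)
  moreover have "(S ^^ 2) ((T ^^ 2) x) = x" for x
    by (simp add: eval_nat_numeral inverse)
  ultimately show ?thesis
    by (simp add: two_isometry_def inverse scaleR_2)
qed

lemma infsum_inj_support:
  assumes "inj h" "\<And>q. q \<notin> range h \<Longrightarrow> g q = 0"
  shows "infsum g UNIV = (\<Sum>\<^sub>\<infinity>p. g (h p))"
proof -
  have "infsum g UNIV = infsum g (range h)"
    by (rule infsum_cong_neutral) (use assms in auto)
  then show ?thesis
    using assms(1) by (simp add: infsum_reindex comp_def)
qed

lemma summable_on_inj_support:
  assumes "inj h" "\<And>q. q \<notin> range h \<Longrightarrow> g q = 0" "(\<lambda>p. g (h p)) summable_on UNIV"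
  shows "g summable_on UNIV"
proof -
  have "g summable_on range h"
    using assms by (simp add: summable_on_reindex comp_def)
  then show ?thesis
    by (rule summable_on_cong_neutral[THEN iffD1, rotated -1]) (use assms in auto)
qed

text \<open>Such a \<open>T\<close> sends the basis monomial with index \<open>p\<close> to the one
  with index \<open>h p\<close>. Its adjoint pulls coefficients back along \<open>h\<close>, which
  is a left inverse of \<open>T\<close>.\<close>

lemma two_isometry_permute_coeffs:
  assumes "inj h"
    and coeff: "\<And>f p. hardy_coeff (T f) (h p) = hardy_coeff f p"
    and coeff_0: "\<And>f q. q \<notin> range h \<Longrightarrow> hardy_coeff (T f) q = 0"
  shows "two_isometry T"
proof -
  \<comment> \<open>By injectivity this reindexes a subfamily of a summable family, so the pullback
    stays in the Hardy space.\<close>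
  have "square_summable (\<lambda>p. hardy_coeff f (h p))" for f
    using hardy_coeff(1)[of f] summable_on_subset_banach[of _ UNIV "range h"] \<open>inj h\<close>
    by (fastforce simp: square_summable_def summable_on_reindex comp_def)
  then have "\<exists>S. \<forall>f. hardy_coeff (S f) = (\<lambda>p. hardy_coeff f (h p))"
    by (intro choice allI) (metis hardy_coeff_surj)
  then obtain S where S: "\<And>f. hardy_coeff (S f) = (\<lambda>p. hardy_coeff f (h p))"
    by blast
  show ?thesis
  proof (rule two_isometry_isometry)
    show "cinner (T f) g = cinner f (S g)" for f g
      by (simp add: cinner_hardy_bidisc_def cinner_hardy_def S
          infsum_inj_support[OF \<open>inj h\<close>, of "\<lambda>q. hardy_coeff (T f) q * cnj (hardy_coeff g q)"]
          coeff coeff_0)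
    show "S (T f) = f" for f
      by (simp add: S coeff flip: hardy_coeff_inject)
  qed
qed

lemma hardy_coeff_monom: "hardy_coeff (hardy_monom m n) = (\<lambda>p. if p = (m, n) then 1 else 0)"
proof (rule hardy_coeff_eqI)
  let ?a = "\<lambda>p::nat \<times> nat. if p = (m, n) then 1 else 0 :: complex"
  show "square_summable ?a"
    by (rule square_summable_finite_support) simp
  have "(\<Sum>\<^sub>\<infinity>(i, j). ?a (i, j) * fst z ^ i * snd z ^ j)
      = (\<Sum>\<^sub>\<infinity>(i, j)\<in>{(m, n)}. ?a (i, j) * fst z ^ i * snd z ^ j)" for z
    by (rule infsum_cong_neutral) (auto split: if_splits)
  then show "hardy_fun (hardy_monom m n) = bidisc_series ?a"
    by (auto simp: fun_eq_iff hardy_monom.rep_eq bidisc_series_def)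
qed

lemma hardy_coeff_mult_z1:
  "hardy_coeff (mult_z1 f) = (\<lambda>(m, n). if m = 0 then 0 else hardy_coeff f (m - 1, n))"
proof (rule hardy_coeff_eqI)
  let ?b = "\<lambda>(m, n). if m = 0 then 0 else hardy_coeff f (m - 1, n)"
  define h :: "nat \<times> nat \<Rightarrow> nat \<times> nat" where "h = apfst Suc"
  have h: "inj h"
    by (auto simp: h_def inj_on_def)
  have fst_0: "fst q = 0" if "q \<notin> range h" for q
    using that by (cases q; cases "fst q") (auto simp: h_def image_iff)
  show "square_summable ?b"
    unfolding square_summable_def
    by (rule summable_on_inj_support[OF h])
      (use hardy_coeff(1)[of f] in
        \<open>auto simp: fst_0 h_def square_summable_def case_prod_unfold\<close>)
  have "(\<Sum>\<^sub>\<infinity>(m, n). ?b (m, n) * fst z ^ m * snd z ^ n)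
      = fst z * (\<Sum>\<^sub>\<infinity>(m, n). hardy_coeff f (m, n) * fst z ^ m * snd z ^ n)" for z
    by (subst infsum_inj_support[OF h])
      (auto simp: fst_0 h_def case_prod_unfold mult_ac simp flip: infsum_cmult_right')
  then show "hardy_fun (mult_z1 f) = bidisc_series ?b"
    by (auto simp: fun_eq_iff mult_z1.rep_eq hardy_coeff(2)[of f] bidisc_series_def)
qed

text \<open>This reads the scalar in the rank-one term as the \<open>z\<^sub>1\<close>-coefficient
  of \<open>f\<close>.\<close>

lemma cinner_hardy_monom: "cinner f (hardy_monom m n) = hardy_coeff f (m, n)"
proof -
  have "cinner f (hardy_monom m n)
      = (\<Sum>\<^sub>\<infinity>p\<in>{(m, n)}. hardy_coeff f p * cnj (hardy_coeff (hardy_monom m n) p))"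
    unfolding cinner_hardy_bidisc_def cinner_hardy_def
    by (rule infsum_cong_neutral) (auto simp: hardy_coeff_monom)
  then show ?thesis
    by (simp add: hardy_coeff_monom)
qed

theorem corollary2p3:
  shows "two_isometry (\<lambda>f. mult_z1 f +
           rank_one (- hardy_monom 2 0 + hardy_monom 0 1) (hardy_monom 1 0) f)"
proof -
  define T where "T = (\<lambda>f. mult_z1 f +
    rank_one (- hardy_monom 2 0 + hardy_monom 0 1) (hardy_monom 1 0) f)"
  let ?h = "\<lambda>p::nat \<times> nat. if p = (1, 0) then (0, 1) else apfst Suc p"
  \<comment> \<open>The shift puts the \<open>z\<^sub>1\<close>-coefficient at index
    \<open>(2, 0)\<close>; the rank-one term cancels it there and places it at
    \<open>(0, 1)\<close>, an index the shift leaves empty.\<close>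
  have coeff: "hardy_coeff (T f) (m, n)
      = (if m = 0 then if n = 1 then hardy_coeff f (1, 0) else 0
         else if (m, n) = (2, 0) then 0 else hardy_coeff f (m - 1, n))" for f m n
    unfolding T_def uminus_add_conv_diff
    by (auto simp: rank_one_def scaleC_hardy_bidisc_def hardy_coeff_add hardy_coeff_scaleC
        hardy_coeff_diff hardy_coeff_mult_z1 hardy_coeff_monom cinner_hardy_monom)
  have "two_isometry T"
  proof (rule two_isometry_permute_coeffs)
    show "inj ?h"
      by (auto simp: inj_on_def)
    show "hardy_coeff (T f) (?h p) = hardy_coeff f p" for f p
      by (cases p) (auto simp: coeff)
    show "hardy_coeff (T f) q = 0" if "q \<notin> range ?h" for f q
    proof -
      obtain m n where q: "q = (m, n)"
        by fastforce
      \<comment> \<open>These are the only possible preimages of \<open>q\<close>; ruling them out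
        leaves only the zero branches of \<open>coeff\<close>. For \<open>m = 0\<close> the second
        fact is harmless, as truncated subtraction gives \<open>m - 1 = 0\<close>.\<close>
      have "q \<noteq> ?h (1, 0)" "q \<noteq> ?h (m - 1, n)"
        using that by blast+
      then show ?thesis
        by (auto simp: q coeff split: if_splits)
    qed
  qed
  then show ?thesis
    unfolding T_def .
qed

end
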